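(* Let $q\ge -1$ be an integer and let $G$ be a $q$-sphere (a finite simple graph as defined in the context). Then $\chi(G)=1+(-1)^q$.
   Context: All graphs are finite simple graphs; $S(v)$ is the subgraph induced by the neighbors of the vertex $v$ and $G\setminus v$ is the graph with $v$ and its edges removed. Contractible graphs are defined recursively: the one-point graph $K_1$ is contractible, and a graph $G$ is contractible if there is a vertex $v$ such that both $S(v)$ and $G\setminus v$ are contractible. The empty graph $0$ is not contractible. Spheres and manifolds are defined recursively: the empty graph is the $(-1)$-sphere; for $q\ge 0$, a $q$-manifold is a graph all of whose unit spheres $S(v)$ are $(q-1)$-spheres, and a $q$-sphere is a $q$-manifold for which there is a vertex $v$ such that $G\setminus v$ is contractible. The Euler characteristic is $\chi(G)=\sum_x(-1)^{\dim(x)}$, the sum over all non-empty cliques $x$ of $G$, where a clique with $k+1$ vertices has dimension $k$. *)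

theory Defs
  imports Complex_Main "Graph_Theory.Kuratowski"
begin

text \<open>
  A finite simple graph is a digraph in the locale \<^locale>\<open>graph\<close> (finite, loop-free, without
  parallel arcs, symmetric): an undirected edge is a pair of opposite arcs. The null graph is
  allowed. Finiteness and simplicity are not part of the predicates below; they are to be used for
  \<open>G\<close> with \<^term>\<open>graph G\<close>, a property inherited by induced subgraphs.
\<close>

definition unit_sphere :: "('a, 'b) pre_digraph \<Rightarrow> 'a \<Rightarrow> ('a, 'b) pre_digraph" where
  "unit_sphere G v = G \<restriction> {u \<in> verts G. v \<rightarrow>\<^bsub>G\<^esub> u}"

abbreviation remove_vertex :: "('a, 'b) pre_digraph \<Rightarrow> 'a \<Rightarrow> ('a, 'b) pre_digraph" where
  "remove_vertex G v \<equiv> pre_digraph.del_vert G v"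

text \<open>
  On finite graphs the recursive descriptions are well-founded: unit spheres and vertex deletions
  have fewer vertices. Hence the least predicates closed under the rules are the recursively
  defined ones.
\<close>

inductive contractible_graph :: "('a, 'b) pre_digraph \<Rightarrow> bool" where
  one_point: "K\<^bsub>1\<^esub> G \<Longrightarrow> contractible_graph G"
| extend: "v \<in> verts G \<Longrightarrow> contractible_graph (unit_sphere G v) \<Longrightarrow>
    contractible_graph (remove_vertex G v) \<Longrightarrow> contractible_graph G"

lemma not_contractible_graph_null: "verts G = {} \<Longrightarrow> \<not> contractible_graph G"
  by (auto elim: contractible_graph.cases simp: complete_digraph_def)

inductive sphere_graph :: "int \<Rightarrow> ('a, 'b) pre_digraph \<Rightarrow> bool"
  and manifold_graph :: "int \<Rightarrow> ('a, 'b) pre_digraph \<Rightarrow> bool" where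
  sphere_null: "verts G = {} \<Longrightarrow> sphere_graph (-1) G"
| sphere: "q \<ge> 0 \<Longrightarrow> manifold_graph q G \<Longrightarrow> v \<in> verts G \<Longrightarrow>
    contractible_graph (remove_vertex G v) \<Longrightarrow> sphere_graph q G"
| manifold: "q \<ge> 0 \<Longrightarrow> (\<forall>v \<in> verts G. sphere_graph (q - 1) (unit_sphere G v)) \<Longrightarrow>
    manifold_graph q G"

definition cliques :: "('a, 'b) pre_digraph \<Rightarrow> 'a set set" where
  "cliques G = {x. x \<subseteq> verts G \<and> x \<noteq> {} \<and> (\<forall>u \<in> x. \<forall>w \<in> x. u \<noteq> w \<longrightarrow> u \<rightarrow>\<^bsub>G\<^esub> w)}"

definition clique_dim :: "'a set \<Rightarrow> nat" where
  "clique_dim x = card x - 1"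

definition euler_char :: "('a, 'b) pre_digraph \<Rightarrow> int" where
  "euler_char G = (\<Sum>x \<in> cliques G. (-1) ^ clique_dim x)"

end

theory Submission
  imports Defs
begin

text \<open>
  The cliques of \<open>G\<close> containing a vertex \<open>v\<close> are \<open>{v}\<close> and the sets \<open>insert v y\<close> for cliques \<open>y\<close> of
  \<open>S(v)\<close>, whose dimension is one more than that of \<open>y\<close>. Hence \<open>\<chi>(G) = \<chi>(G \ v) + 1 - \<chi>(S(v))\<close>, which
  gives \<open>\<chi> = 1\<close> for contractible graphs and then \<open>\<chi>(G) = 2 - \<chi>(S(v))\<close> for spheres.
\<close>

lemma dominates_induce_subgraph_iff:
  "u \<rightarrow>\<^bsub>G \<restriction> S\<^esub> w \<longleftrightarrow> u \<in> S \<and> w \<in> S \<and> u \<rightarrow>\<^bsub>G\<^esub> w"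
  by (auto simp: arcs_ends_def arc_to_ends_def image_iff)

lemma dominates_remove_vertex_iff:
  "u \<rightarrow>\<^bsub>remove_vertex G v\<^esub> w \<longleftrightarrow> u \<noteq> v \<and> w \<noteq> v \<and> u \<rightarrow>\<^bsub>G\<^esub> w"
  by (auto simp: arcs_ends_def arc_to_ends_def image_iff pre_digraph.del_vert_def)

context graph
begin

lemma graph_induce_subgraph:
  assumes "S \<subseteq> verts G"
  shows "graph (G \<restriction> S)"
proof -
  have "induced_subgraph (G \<restriction> S) G" using assms by (rule induced_induce)
  then interpret H: sym_digraph "G \<restriction> S" by (rule induced_graph_imp_graph)
  \<comment> \<open>\<open>H\<close> supplies well-formedness and symmetry; finiteness and the
    absence of loops and of parallel arcs are inherited from \<open>G\<close>.\<close>
  show ?thesis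
    using assms no_loops no_multi_arcs finite_subset[OF assms]
    by unfold_locales (auto simp: arc_to_ends_def)
qed

lemma graph_remove_vertex: "graph (remove_vertex G v)"
proof -
  have "remove_vertex G v = G \<restriction> (verts G - {v})"
    by (auto simp: del_vert_def induce_subgraph_def)
  then show ?thesis by (simp add: graph_induce_subgraph)
qed

lemma graph_unit_sphere: "graph (unit_sphere G v)"
  unfolding unit_sphere_def by (rule graph_induce_subgraph) auto

lemma finite_cliques: "finite (cliques G)"
  by (rule finite_subset[of _ "Pow (verts G)"]) (auto simp: cliques_def)

lemma finite_clique: "x \<in> cliques G \<Longrightarrow> finite x"
  by (auto simp: cliques_def intro: finite_subset)

lemma cliques_remove_vertex: "cliques (remove_vertex G v) = {x \<in> cliques G. v \<notin> x}"
  by (auto simp: cliques_def dominates_remove_vertex_iff verts_del_vert)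

text \<open>Since \<open>G\<close> has no loops, \<open>v\<close> is not its own neighbor. This
  makes \<open>insert v\<close> injective on the cliques of S(v) and lets it raise the cardinality
  by exactly one.\<close>

lemma not_in_clique_unit_sphere:
  assumes "y \<in> cliques (unit_sphere G v)"
  shows "v \<notin> y"
  using assms adj_not_same by (auto simp: cliques_def unit_sphere_def)

text \<open>Removing \<open>v\<close> from such a clique leaves a clique of S(v) or the empty set.
  The empty set is not a clique, so \<open>{v}\<close> has to be listed separately.\<close>

lemma cliques_containing_vertex:
  assumes "v \<in> verts G"
  shows "{x \<in> cliques G. v \<in> x} = insert {v} (insert v ` cliques (unit_sphere G v))"
    (is "?L = ?R")
proof (intro set_eqI iffI)
  fix x assume x: "x \<in> ?L"
  show "x \<in> ?R"
  proof (cases "x = {v}")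
    case False
    with x have "x - {v} \<in> cliques (unit_sphere G v)"
      by (auto simp: cliques_def unit_sphere_def dominates_induce_subgraph_iff)
    moreover have "x = insert v (x - {v})" using x by auto
    ultimately show ?thesis by blast
  qed simp
next
  fix x assume "x \<in> ?R"
  \<comment> \<open>Membership in S(v) only gives arcs out of \<open>v\<close>; symmetry provides
    the arcs back to \<open>v\<close>.\<close>
  then show "x \<in> ?L"
    using assms graph_symmetric
    by (auto simp: cliques_def unit_sphere_def dominates_induce_subgraph_iff)
qed

lemma euler_char_remove_vertex:
  assumes v: "v \<in> verts G"
  shows "euler_char G = euler_char (remove_vertex G v) + 1 - euler_char (unit_sphere G v)"
proof -
  interpret S: graph "unit_sphere G v" by (rule graph_unit_sphere)
  let ?f = "\<lambda>x :: 'a set. (-1 :: int) ^ clique_dim x"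
  let ?C = "cliques (unit_sphere G v)"
  have inj: "inj_on (insert v) ?C"
    by (rule inj_onI) (simp add: not_in_clique_unit_sphere insert_ident)
  have dim: "?f (insert v y) = - ?f y" if y: "y \<in> ?C" for y
  proof -
    \<comment> \<open>Non-emptiness matters: \<open>clique_dim\<close> truncates at 0, so the empty
      set and \<open>{v}\<close> would both get dimension 0 and the sign would not flip.\<close>
    have "finite y" "y \<noteq> {}" using y S.finite_clique by (auto simp: cliques_def)
    then obtain n where "card y = Suc n" by (metis card_eq_0_iff not0_implies_Suc)
    then show ?thesis
      using \<open>finite y\<close> not_in_clique_unit_sphere[OF y] by (simp add: clique_dim_def)
  qed
  have "{v} \<notin> insert v ` ?C"
  proof
    assume "{v} \<in> insert v ` ?C"
    then obtain y where y: "y \<in> ?C" "{v} = insert v y" by (rule imageE)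
    moreover have "y \<noteq> {}" using y(1) by (simp add: cliques_def)
    ultimately show False using not_in_clique_unit_sphere[OF y(1)] by blast
  qed
  then have "sum ?f {x \<in> cliques G. v \<in> x} = ?f {v} + sum ?f (insert v ` ?C)"
    by (simp add: cliques_containing_vertex[OF v] S.finite_cliques)
  also have "sum ?f (insert v ` ?C) = - euler_char (unit_sphere G v)"
    by (simp add: sum.reindex[OF inj] dim euler_char_def sum_negf)
  finally have "sum ?f {x \<in> cliques G. v \<in> x} = 1 - euler_char (unit_sphere G v)"
    by (simp add: clique_dim_def)
  moreover have "euler_char G = sum ?f {x \<in> cliques G. v \<notin> x} + sum ?f {x \<in> cliques G. v \<in> x}"
    unfolding euler_char_def
    using sum.Int_Diff[OF finite_cliques, of ?f "{x. v \<notin> x}"]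
    by (simp add: Int_def set_diff_eq)
  ultimately show ?thesis
    by (simp add: euler_char_def cliques_remove_vertex)
qed

end

lemma euler_char_contractible:
  assumes "contractible_graph G" "graph G"
  shows "euler_char G = 1"
  using assms
proof induction
  case (one_point G)
  then obtain v where "verts G = {v}"
    by (auto simp: complete_digraph_def card_1_singleton_iff)
  then have "cliques G = {{v}}" by (auto simp: cliques_def)
  then show ?case by (simp add: euler_char_def clique_dim_def)
next
  case (extend v G)
  interpret graph G by fact
  show ?case
    \<comment> \<open>Both smaller graphs have Euler characteristic 1, and 1 + 1 - 1 = 1.\<close>
    using extend euler_char_remove_vertex[OF extend.hyps(1)] graph_unit_sphere graph_remove_vertex
    by simp
qed

text \<open>The induction is mutual. A manifold's own Euler characteristic is not determined by
  \<open>q\<close>, so the manifold half records the values of its unit spheres instead.\<close>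

lemma euler_char_sphere:
  "sphere_graph q G \<Longrightarrow> graph G \<Longrightarrow> real_of_int (euler_char G) = 1 + (-1) powi q"
  "manifold_graph q G \<Longrightarrow> graph G \<Longrightarrow> v \<in> verts G \<Longrightarrow>
    real_of_int (euler_char (unit_sphere G v)) = 1 + (-1) powi (q - 1)"
proof (induction arbitrary: and v rule: sphere_graph_manifold_graph.inducts)
  \<comment> \<open>The empty sum 0 agrees with 1 + (-1) powi (-1), an inverse power taken in the
    reals.\<close>
  case (sphere_null G)
  then have "cliques G = {}" by (auto simp: cliques_def)
  then show ?case by (simp add: euler_char_def)
next
  case (sphere q G v)
  interpret graph G by fact
  have "euler_char (remove_vertex G v) = 1"
    using sphere euler_char_contractible graph_remove_vertex by blast
  \<comment> \<open>With this sign change, 1 + 1 - (1 + (-1)^(q-1)) becomes 1 + (-1)^q.\<close>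
  moreover have "(-1 :: real) powi (q - 1) = - ((-1) powi q)"
    by (simp add: power_int_diff)
  ultimately show ?case
    using sphere euler_char_remove_vertex[of v] by simp
next
  case (manifold q G)
  interpret graph G by fact
  show ?case using manifold graph_unit_sphere by blast
qed

theorem mainTheorem4:
  fixes q :: int and G :: "('a, 'b) pre_digraph"
  assumes "q \<ge> -1"
    and "graph G"
    and "sphere_graph q G"
  shows "real_of_int (euler_char G) = 1 + (-1) powi q"
  using assms euler_char_sphere(1) by blast

end
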